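(* For each positive integer $K$ let $Q_K$ be an even real polynomial in one variable of degree at most $K$ with $Q_K(0)=0$, and suppose there is a constant $C$ such that $\max_{t\in[-1,1]}\big|Q_K(t)-|t|\big|\le\frac CK$ for all $K$. Then $$\limsup_{K\to\infty}\frac1K\sup_{0<|t|\le1}\frac{\Big||t|-\big|Q_K(t)-|t|\big|\Big|}{t^2}<\infty .$$ *)

theory Defs
  imports "HOL-Analysis.Analysis" "HOL-Computational_Algebra.Polynomial"
begin

end

theory Submission
  imports Defs "HOL-Complex_Analysis.Conformal_Mappings"
begin

text \<open>
  Since \<open>\<bar>\<bar>a\<bar> - \<bar>b\<bar>\<bar> \<le> \<bar>a + b\<bar>\<close>, the numerator is at most \<open>\<bar>Q\<^sub>K(t)\<bar>\<close>, so the claim follows from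
  \<open>\<bar>Q\<^sub>K(t)\<bar> \<le> A K t\<^sup>2\<close> on \<open>[-1,1]\<close> with a constant \<open>A\<close>. For \<open>\<bar>t\<bar> \<ge> 1/K\<close> this is immediate, because
  there \<open>\<bar>Q\<^sub>K(t)\<bar> \<le> \<bar>t\<bar> + C/K \<le> (1 + C) \<bar>t\<bar>\<close> and \<open>\<bar>t\<bar> \<le> K t\<^sup>2\<close>.

  Near \<open>0\<close> the approximation hypothesis says too little, and the degree bound has to be used. As
  \<open>Q\<^sub>K\<close> is even and vanishes at \<open>0\<close>, it has the form \<open>t\<^sup>2 p(t\<^sup>2)\<close> for a polynomial \<open>p\<close> of degree at
  most \<open>K\<close>, and the easy case reads \<open>\<bar>p\<bar> \<le> (1 + C) K\<close> on \<open>[1/K\<^sup>2, 1]\<close>. The point \<open>0\<close> is so close to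
  this interval that \<open>p\<close> cannot grow by more than a constant factor on \<open>[0, 1/K\<^sup>2]\<close>
  (\<open>poly_bound_extends_to_gap\<close>). That growth estimate is the Bernstein--Walsh inequality
  (\<open>bernstein_walsh_real\<close>), rescaled: outside \<open>[-1,1]\<close>, a polynomial of degree \<open>n\<close> bounded by \<open>M\<close> on
  \<open>[-1,1]\<close> is bounded by \<open>M (y + sqrt (y\<^sup>2 - 1))\<^sup>n\<close>. The excess of \<open>y\<close> over \<open>1\<close> is of order \<open>1/K\<^sup>2\<close>,
  so the square root is of order \<open>1/K\<close>, and its \<open>K\<close>-th power stays bounded.
\<close>

section \<open>Growth of polynomials outside an interval\<close>

text \<open>
  In terms of the Joukowski map \<open>J v = (v + 1/v)/2\<close>, the function \<open>g v = v\<^sup>n p (J v)\<close> is a polynomial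
  in \<open>v\<close>, since \<open>p\<close> has degree at most \<open>n\<close>. The unit circle is mapped by \<open>J\<close> onto \<open>[-1,1]\<close>, so
  \<open>\<bar>g\<bar> \<le> M\<close> there; the maximum modulus principle carries this bound to \<open>v = 1/w\<close> in the closed
  disc, where \<open>w = y + sqrt (y\<^sup>2 - 1)\<close> is the root of \<open>J w = y\<close> with \<open>w \<ge> 1\<close> and \<open>J (1/w) = J w\<close>.
\<close>

lemma bernstein_walsh_real:
  fixes p :: "real poly"
  assumes deg: "degree p \<le> n"
    and M: "\<And>x. -1 \<le> x \<Longrightarrow> x \<le> 1 \<Longrightarrow> \<bar>poly p x\<bar> \<le> M"
    and y: "y \<ge> 1"
  shows "\<bar>poly p y\<bar> \<le> M * (y + sqrt (y\<^sup>2 - 1)) ^ n"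
proof -
  define g :: "complex \<Rightarrow> complex" where
    "g v = (\<Sum>k\<le>n. of_real (coeff p k) * v ^ (n - k) * ((v\<^sup>2 + 1) / 2) ^ k)" for v
  (* Stated with s in place of J v, so that it serves the circle (s = Re v) and the point 1/w alike. *)
  have g_eq: "g v = v ^ n * of_real (poly p s)" if "(v\<^sup>2 + 1) / 2 = v * of_real s" for v s
  proof -
    have p_sum: "poly p s = (\<Sum>k\<le>n. coeff p k * s ^ k)"
      unfolding poly_altdef using deg
      by (intro sum.mono_neutral_left) (auto simp: coeff_eq_0)
    have "g v = (\<Sum>k\<le>n. v ^ n * (of_real (coeff p k) * of_real s ^ k))"
      unfolding g_def that
    proof (intro sum.cong refl)
      fix k assume "k \<in> {..n}"
      then have "v ^ n = v ^ (n - k) * v ^ k" by (simp flip: power_add)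
      then show "of_real (coeff p k) * v ^ (n - k) * (v * of_real s) ^ k
          = v ^ n * (of_real (coeff p k) * of_real s ^ k)"
        by (simp add: power_mult_distrib mult_ac)
    qed
    then show ?thesis
      by (simp add: p_sum sum_distrib_left)
  qed
  have circle: "norm (g v) \<le> M" if "norm v = 1" for v
  proof -
    have "v * cnj v = 1"
      using complex_norm_square[of v] that by simp
    then have "v\<^sup>2 + 1 = v * (v + cnj v)"
      by (simp add: power2_eq_square algebra_simps)
    then have "(v\<^sup>2 + 1) / 2 = v * of_real (Re v)"
      by (simp add: complex_add_cnj)
    from g_eq[OF this] have "norm (g v) = \<bar>poly p (Re v)\<bar>"
      by (simp add: norm_mult norm_power that)
    moreover have "\<bar>Re v\<bar> \<le> 1"
      using abs_Re_le_cmod[of v] that by simp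
    ultimately show ?thesis
      using M[of "Re v"] by (simp add: abs_le_iff)
  qed
  have hol: "g holomorphic_on A" for A
    unfolding g_def by (intro holomorphic_intros) auto
  have disc: "norm (g v) \<le> M" if "norm v \<le> 1" for v
  proof (rule maximum_modulus_frontier[of g "cball 0 1"])
    show "continuous_on (closure (cball 0 1)) g"
      by (rule holomorphic_on_imp_continuous_on[OF hol])
  qed (use that circle hol in \<open>auto simp: frontier_cball\<close>)
  define w where "w = y + sqrt (y\<^sup>2 - 1)"
  have y2: "y\<^sup>2 - 1 \<ge> 0" using y by (simp add: one_le_power)
  have w1: "w \<ge> 1" unfolding w_def using y y2 by (simp add: add_increasing2)
  have "(w - y)\<^sup>2 = y\<^sup>2 - 1" using y2 by (simp add: w_def)
  then have "w\<^sup>2 + 1 = 2 * y * w" by (simp add: power2_diff algebra_simps)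
  then have J: "((1 / w)\<^sup>2 + 1) / 2 = (1 / w) * y"
    using w1 by (simp add: field_simps power2_eq_square)
  have "((complex_of_real (1 / w))\<^sup>2 + 1) / 2 = of_real (1 / w) * of_real y"
    using arg_cong[OF J, of complex_of_real] by simp
  then have "norm (g (of_real (1 / w))) = (1 / w) ^ n * \<bar>poly p y\<bar>"
    using w1 by (simp add: g_eq norm_mult norm_power norm_divide)
  then have "\<bar>poly p y\<bar> = norm (g (of_real (1 / w))) * w ^ n"
    using w1 by (simp add: field_simps)
  moreover have "norm (g (of_real (1 / w))) \<le> M"
    using w1 by (intro disc) (simp add: norm_divide)
  ultimately show ?thesis
    using w1 by (simp add: mult_right_mono flip: w_def)
qed

text \<open>
  The affine map from \<open>[-1,1]\<close> onto \<open>[h\<^sup>2,1]\<close>, taken orientation-reversing so that the gap lies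
  beyond \<open>1\<close>, sends \<open>Y = (1 + h\<^sup>2)/(1 - h\<^sup>2)\<close> to \<open>0\<close>. The growth factor at \<open>Y\<close> collapses to
  \<open>(1 + h)/(1 - h)\<close>, which is \<open>1 + O(h)\<close>: a gap of length \<open>h\<^sup>2\<close> costs only \<open>O(h)\<close> per degree.
\<close>

lemma poly_bound_extends_to_gap:
  fixes p :: "real poly"
  assumes deg: "degree p \<le> n"
    and h: "0 < h" "h \<le> 1 / 2"
    and M: "\<And>x. h\<^sup>2 \<le> x \<Longrightarrow> x \<le> 1 \<Longrightarrow> \<bar>poly p x\<bar> \<le> M"
    and x: "0 \<le> x" "x \<le> h\<^sup>2"
  shows "\<bar>poly p x\<bar> \<le> M * exp (4 * h * real n)"
proof -
  have h2: "h\<^sup>2 < 1" using h by (simp add: power_less_one_iff)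
  have M0: "M \<ge> 0" using M[of 1] h2 by simp
  define q where "q = pcompose p [:(1 + h\<^sup>2) / 2, - ((1 - h\<^sup>2) / 2):]"
  have q: "poly q s = poly p ((1 + h\<^sup>2) / 2 - s * ((1 - h\<^sup>2) / 2))" for s
    by (simp add: q_def poly_pcompose)
  have "degree q \<le> degree p * degree [:(1 + h\<^sup>2) / 2, - ((1 - h\<^sup>2) / 2):]"
    unfolding q_def by (rule degree_pcompose_le)
  also have "\<dots> \<le> degree p" by simp
  finally have degq: "degree q \<le> n" using deg by simp
  have Mq: "\<bar>poly q s\<bar> \<le> M" if "-1 \<le> s" "s \<le> 1" for s
  proof -
    have "\<bar>s * ((1 - h\<^sup>2) / 2)\<bar> \<le> 1 * ((1 - h\<^sup>2) / 2)"
      unfolding abs_mult using that h2 by (intro mult_mono) auto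
    then show ?thesis unfolding q by (intro M) (auto simp: abs_le_iff field_simps)
  qed
  define y where "y = (1 + h\<^sup>2 - 2 * x) / (1 - h\<^sup>2)"
  define Y where "Y = (1 + h\<^sup>2) / (1 - h\<^sup>2)"
  have y1: "1 \<le> y" using x h2 by (simp add: y_def field_simps)
  have yY: "y \<le> Y" using x h2 by (simp add: y_def Y_def divide_right_mono)
  have "Y\<^sup>2 - 1 = (2 * h / (1 - h\<^sup>2))\<^sup>2"
  proof -
    have "Y\<^sup>2 - 1 = ((1 + h\<^sup>2)\<^sup>2 - (1 - h\<^sup>2)\<^sup>2) / (1 - h\<^sup>2)\<^sup>2"
      using h2 by (simp add: Y_def power_divide diff_divide_distrib)
    also have "(1 + h\<^sup>2)\<^sup>2 - (1 - h\<^sup>2)\<^sup>2 = (2 * h)\<^sup>2"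
      by (simp add: power2_eq_square algebra_simps)
    finally show ?thesis by (simp add: power_divide)
  qed
  then have sqrtY: "sqrt (Y\<^sup>2 - 1) = 2 * h / (1 - h\<^sup>2)"
    using h h2 by simp
  have "sqrt (y\<^sup>2 - 1) \<le> sqrt (Y\<^sup>2 - 1)"
    using y1 yY by (simp add: power_mono)
  then have "y + sqrt (y\<^sup>2 - 1) \<le> Y + 2 * h / (1 - h\<^sup>2)"
    using yY sqrtY by simp
  also have "\<dots> = (1 + h)\<^sup>2 / ((1 - h) * (1 + h))"
    by (simp add: Y_def add_divide_distrib[symmetric] power2_eq_square algebra_simps)
  also have "\<dots> = (1 + h) / (1 - h)"
    using h by (simp add: power2_eq_square)
  also have "\<dots> \<le> 1 + 4 * h"
  proof -
    have "h * h \<le> h * (1 / 2)" using h by (intro mult_left_mono) auto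
    then show ?thesis using h by (simp add: divide_le_eq algebra_simps)
  qed
  also have "\<dots> \<le> exp (4 * h)" by (rule exp_ge_add_one_self)
  finally have w: "y + sqrt (y\<^sup>2 - 1) \<le> exp (4 * h)" .
  have "y\<^sup>2 - 1 \<ge> 0" using y1 by (simp add: one_le_power)
  then have w0: "0 \<le> y + sqrt (y\<^sup>2 - 1)" using y1 by simp
  have "y * ((1 - h\<^sup>2) / 2) = (1 + h\<^sup>2) / 2 - x"
    using h2 by (simp add: y_def field_simps)
  then have "(1 + h\<^sup>2) / 2 - y * ((1 - h\<^sup>2) / 2) = x"
    by linarith
  then have "poly p x = poly q y"
    by (simp only: q)
  then have "\<bar>poly p x\<bar> \<le> M * (y + sqrt (y\<^sup>2 - 1)) ^ n"
    using bernstein_walsh_real[OF degq Mq y1] by simp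
  also have "\<dots> \<le> M * exp (4 * h) ^ n"
    using w w0 M0 by (intro mult_left_mono power_mono)
  also have "exp (4 * h) ^ n = exp (4 * h * real n)"
    by (simp add: mult.commute flip: exp_of_nat_mult)
  finally show ?thesis .
qed

section \<open>Even polynomials\<close>

text \<open>
  A polynomial over an infinite field is determined by its values, so \<open>Q(-t) = Q(t)\<close> compares
  coefficients and, in characteristic \<open>0\<close>, removes those of odd index.
\<close>

lemma even_poly_in_square:
  fixes Q :: "'a :: field_char_0 poly"
  assumes even: "\<And>t. poly Q (- t) = poly Q t"
  obtains q where "degree q \<le> degree Q" "\<And>t. poly Q t = poly q (t\<^sup>2)"
proof
  let ?n = "degree Q"
  let ?q = "\<Sum>i\<le>?n. monom (coeff Q (2 * i)) i"
  have "pcompose Q [:0, -1:] = Q"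
    by (simp add: poly_eq_poly_eq_iff[symmetric] fun_eq_iff poly_pcompose even)
  then have "coeff Q k = (-1) ^ k * coeff Q k" for k
    using coeff_pcompose_linear[of Q "-1" k] by simp
  from this[of "Suc (2 * i)" for i] have neg: "coeff Q (Suc (2 * i)) = - coeff Q (Suc (2 * i))" for i
    by simp
  have "coeff Q (Suc (2 * i)) + coeff Q (Suc (2 * i)) = 0" for i
    using neg[of i] by (rule eq_neg_iff_add_eq_0[THEN iffD1])
  then have odd0: "coeff Q (Suc (2 * i)) = 0" for i
    by (metis mult_2 mult_eq_0_iff zero_neq_numeral)
  have split: "(\<Sum>k\<le>Suc (2 * m). f k) = (\<Sum>i\<le>m. f (2 * i) + f (Suc (2 * i)))"
    for f :: "nat \<Rightarrow> 'a" and m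
    by (induction m) (auto simp: add.assoc)
  show "degree ?q \<le> degree Q"
    by (intro degree_sum_le) (auto intro: order.trans[OF degree_monom_le])
  fix t
  have "poly Q t = (\<Sum>k\<le>Suc (2 * ?n). coeff Q k * t ^ k)"
    unfolding poly_altdef by (intro sum.mono_neutral_left) (auto simp: coeff_eq_0)
  also have "\<dots> = poly ?q (t\<^sup>2)"
    unfolding split by (simp add: odd0 poly_sum poly_monom power_mult)
  finally show "poly Q t = poly ?q (t\<^sup>2)" .
qed

section \<open>Approximants of the absolute value\<close>

text \<open>
  The gap is taken with \<open>h = 1/K\<close>, the point where the error \<open>C/K\<close> becomes comparable to \<open>\<bar>t\<bar>\<close>. The
  growth factor \<open>exp (4 h K)\<close> is then \<open>exp 4\<close>, independent of \<open>K\<close>.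
\<close>

lemma even_approximant_abs_le_square:
  fixes Q :: "real poly"
  assumes K: "K \<ge> 2" and deg: "degree Q \<le> K"
    and even: "\<And>t. poly Q (- t) = poly Q t"
    and zero: "poly Q 0 = 0"
    and approx: "\<And>t. \<bar>t\<bar> \<le> 1 \<Longrightarrow> \<bar>poly Q t - \<bar>t\<bar>\<bar> \<le> C / real K"
    and t: "\<bar>t\<bar> \<le> 1"
  shows "\<bar>poly Q t\<bar> \<le> (1 + C) * exp 4 * real K * t\<^sup>2"
proof -
  have "0 \<le> C / real K" using approx[of 0] zero by simp
  then have C: "C \<ge> 0" using K by (simp add: zero_le_divide_iff)
  obtain q where degq: "degree q \<le> degree Q" and q: "\<And>t. poly Q t = poly q (t\<^sup>2)"
    using even_poly_in_square[OF even] by blast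
  obtain a p where qp: "q = pCons a p" by (cases q) auto
  have a0: "a = 0" using zero q[of 0] by (simp add: qp)
  have Qp: "poly Q t = t\<^sup>2 * poly p (t\<^sup>2)" for t
    unfolding q by (simp add: qp a0)
  have "degree p \<le> degree q" by (simp add: qp degree_pCons_eq_if)
  then have degp: "degree p \<le> K" using degq deg by simp
  define h where "h = 1 / real K"
  have h: "0 < h" "h \<le> 1 / 2" "h * real K = 1" using K by (auto simp: h_def field_simps)
  define M where "M = (1 + C) * real K"
  have outer: "\<bar>poly p x\<bar> \<le> M" if x: "h\<^sup>2 \<le> x" "x \<le> 1" for x
  proof -
    define s where "s = sqrt x"
    have s: "h \<le> s" "s \<le> 1" "s\<^sup>2 = x"
      unfolding s_def using x h order_trans[OF zero_le_power2 x(1)] by (auto intro: real_le_rsqrt)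
    have "\<bar>poly Q s\<bar> \<le> s + C / real K"
      using approx[of s] s h by (simp add: abs_le_iff)
    also have "C / real K = C * h" by (simp add: h_def)
    also have "s + C * h \<le> s + C * s" using C s by (simp add: mult_left_mono)
    also have "\<dots> = (1 + C) * (s * (h * real K))" by (simp add: h algebra_simps)
    also have "\<dots> \<le> (1 + C) * (s * (s * real K))"
      using C s h by (intro mult_left_mono mult_right_mono) auto
    also have "\<dots> = s\<^sup>2 * M" by (simp add: M_def power2_eq_square)
    finally have "s\<^sup>2 * \<bar>poly p x\<bar> \<le> s\<^sup>2 * M" unfolding Qp s(3)[symmetric] by (simp add: abs_mult)
    moreover have "s\<^sup>2 > 0" using s(1) h(1) by (intro zero_less_power) linarith
    ultimately show ?thesis by (simp add: mult_le_cancel_left_pos)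
  qed
  have M0: "M \<ge> 0" using C by (simp add: M_def)
  have "\<bar>poly p (t\<^sup>2)\<bar> \<le> M * exp 4"
  proof (cases "h\<^sup>2 \<le> t\<^sup>2")
    case True
    then have "\<bar>poly p (t\<^sup>2)\<bar> \<le> M" using t by (intro outer) (auto simp: abs_square_le_1)
    also have "\<dots> \<le> M * exp 4" using M0 by (simp add: mult_le_cancel_left1)
    finally show ?thesis .
  next
    case False
    then show ?thesis
      using poly_bound_extends_to_gap[OF degp h(1,2) outer, of "t\<^sup>2"] h(3) by (simp add: mult.assoc)
  qed
  then have "t\<^sup>2 * \<bar>poly p (t\<^sup>2)\<bar> \<le> t\<^sup>2 * (M * exp 4)" by (intro mult_left_mono) auto
  then show ?thesis by (simp add: Qp abs_mult M_def mult_ac)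
qed

theorem lemma6:
  fixes Q :: "nat \<Rightarrow> real poly"
  assumes "\<And>K. K \<ge> 1 \<Longrightarrow> degree (Q K) \<le> K"
    and "\<And>K t. K \<ge> 1 \<Longrightarrow> poly (Q K) (- t) = poly (Q K) t"
    and "\<And>K. K \<ge> 1 \<Longrightarrow> poly (Q K) 0 = 0"
    and "\<exists>C::real. \<forall>K\<ge>1. (SUP t\<in>{-1..1}. \<bar>poly (Q K) t - \<bar>t\<bar>\<bar>) \<le> C / real K"
  shows "limsup (\<lambda>K. ereal (1 / real K) *
           (SUP t\<in>{t::real. 0 < \<bar>t\<bar> \<and> \<bar>t\<bar> \<le> 1}.
              ereal (\<bar>\<bar>t\<bar> - \<bar>poly (Q K) t - \<bar>t\<bar>\<bar>\<bar> / t\<^sup>2))) < \<infinity>"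
proof -
  obtain C where C: "\<And>K. K \<ge> 1 \<Longrightarrow> (SUP t\<in>{-1..1}. \<bar>poly (Q K) t - \<bar>t\<bar>\<bar>) \<le> C / real K"
    using assms(4) by blast
  (* A supremum of reals bounds its members only once the set is known to be bounded above. *)
  have approx: "\<bar>poly (Q K) t - \<bar>t\<bar>\<bar> \<le> C / real K" if "K \<ge> 1" "\<bar>t\<bar> \<le> 1" for K t
  proof -
    have "compact ((\<lambda>t. \<bar>poly (Q K) t - \<bar>t\<bar>\<bar>) ` {-1..1})"
      by (intro compact_continuous_image continuous_intros) auto
    then have "bdd_above ((\<lambda>t. \<bar>poly (Q K) t - \<bar>t\<bar>\<bar>) ` {-1..1})"
      by (intro bounded_imp_bdd_above compact_imp_bounded)
    then have "\<bar>poly (Q K) t - \<bar>t\<bar>\<bar> \<le> (SUP t\<in>{-1..1}. \<bar>poly (Q K) t - \<bar>t\<bar>\<bar>)"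
      using that(2) by (intro cSUP_upper) auto
    then show ?thesis using C[OF that(1)] by simp
  qed
  let ?S = "\<lambda>K. SUP t\<in>{t::real. 0 < \<bar>t\<bar> \<and> \<bar>t\<bar> \<le> 1}.
              ereal (\<bar>\<bar>t\<bar> - \<bar>poly (Q K) t - \<bar>t\<bar>\<bar>\<bar> / t\<^sup>2)"
  define A where "A = (1 + C) * exp 4"
  have bound: "ereal (1 / real K) * ?S K \<le> ereal A" if K: "K \<ge> 2" for K
  proof -
    have "?S K \<le> ereal (A * real K)"
    proof (intro SUP_least)
      fix t :: real assume t: "t \<in> {t. 0 < \<bar>t\<bar> \<and> \<bar>t\<bar> \<le> 1}"
      have "\<bar>\<bar>t\<bar> - \<bar>poly (Q K) t - \<bar>t\<bar>\<bar>\<bar> \<le> \<bar>poly (Q K) t\<bar>" by linarith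
      also have "\<dots> \<le> A * real K * t\<^sup>2"
        unfolding A_def using K t
        by (intro even_approximant_abs_le_square) (auto simp: assms(1-3) approx)
      finally show "ereal (\<bar>\<bar>t\<bar> - \<bar>poly (Q K) t - \<bar>t\<bar>\<bar>\<bar> / t\<^sup>2) \<le> ereal (A * real K)"
        using t by (simp add: divide_le_eq)
    qed
    then have "ereal (1 / real K) * ?S K \<le> ereal (1 / real K) * ereal (A * real K)"
      by (intro ereal_mult_left_mono) auto
    also have "\<dots> = ereal A" using K by simp
    finally show ?thesis .
  qed
  have "limsup (\<lambda>K. ereal (1 / real K) * ?S K) \<le> ereal A"
    by (intro Limsup_bounded eventually_sequentiallyI[of 2] bound)
  also have "\<dots> < \<infinity>" by simp
  finally show ?thesis .
qed

end
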